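(* Let $p$ be a prime and let $G$ be a finite group with centre $Z(G)$ such that $\frac{G}{Z(G)} \cong \mathbb{Z}_p \times \mathbb{Z}_p$. Then the Laplacian spectrum of the non-commuting graph $\mathcal{A}_G$ of $G$ is $$\{0, ((p^2-p)|Z(G)|)^{(p^2-1)|Z(G)|-p-1}, ((p^2-1)|Z(G)|)^p\}.$$
   Context: For a finite non-abelian group $G$, the non-commuting graph $\mathcal{A}_G$ is the simple undirected graph with vertex set $G \setminus Z(G)$ in which two vertices $x,y$ are adjacent if and only if $xy \neq yx$. The Laplacian matrix of a finite graph is $D - A$, with $D$ the degree matrix and $A$ the adjacency matrix. The Laplacian spectrum is the multiset of eigenvalues of the Laplacian matrix; $\{\dots,\alpha^{a},\dots\}$ means the eigenvalue $\alpha$ is listed $a$ times (no exponent means once, exponent $0$ means the entry is absent, and if listed values coincide their multiplicities add). $\mathbb{Z}_p$ is the cyclic group of order $p$. *)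

theory Defs
  imports
    "HOL-Computational_Algebra.Primes"
    "HOL-Algebra.Elementary_Groups"
    "Jordan_Normal_Form.Char_Poly"
begin

definition centre :: "('a, 'b) monoid_scheme \<Rightarrow> 'a set" where
  "centre G = {z \<in> carrier G. \<forall>x\<in>carrier G. z \<otimes>\<^bsub>G\<^esub> x = x \<otimes>\<^bsub>G\<^esub> z}"

text \<open>A simple undirected graph is a pair of a vertex set and a set of
  two-element sets of vertices, its edges.\<close>

type_synonym 'a ugraph = "'a set \<times> 'a set set"

definition verts :: "'a ugraph \<Rightarrow> 'a set" where
  "verts \<Gamma> = fst \<Gamma>"

definition edges :: "'a ugraph \<Rightarrow> 'a set set" where
  "edges \<Gamma> = snd \<Gamma>"

definition adjacent :: "'a ugraph \<Rightarrow> 'a \<Rightarrow> 'a \<Rightarrow> bool" where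
  "adjacent \<Gamma> x y \<longleftrightarrow> {x, y} \<in> edges \<Gamma>"

definition degree_of :: "'a ugraph \<Rightarrow> 'a \<Rightarrow> nat" where
  "degree_of \<Gamma> x = card {y \<in> verts \<Gamma>. adjacent \<Gamma> x y}"

definition noncommuting_graph :: "('a, 'b) monoid_scheme \<Rightarrow> 'a ugraph" where
  "noncommuting_graph G =
    (carrier G - centre G,
     {{x, y} | x y. x \<in> carrier G - centre G \<and> y \<in> carrier G - centre G \<and>
                    x \<otimes>\<^bsub>G\<^esub> y \<noteq> y \<otimes>\<^bsub>G\<^esub> x})"

text \<open>The rows and columns of a matrix are numbered, so the matrices of a finite graph
  depend on a list \<open>vs\<close> enumerating its vertices without repetition.  A different
  enumeration conjugates them by a permutation matrix.\<close>

definition is_enumeration :: "'a ugraph \<Rightarrow> 'a list \<Rightarrow> bool" where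
  "is_enumeration \<Gamma> vs \<longleftrightarrow> distinct vs \<and> set vs = verts \<Gamma>"

definition degree_matrix :: "'a ugraph \<Rightarrow> 'a list \<Rightarrow> 'b::ring_1 mat" where
  "degree_matrix \<Gamma> vs = mat (length vs) (length vs)
     (\<lambda>(i, j). if i = j then of_nat (degree_of \<Gamma> (vs ! i)) else 0)"

definition adjacency_matrix :: "'a ugraph \<Rightarrow> 'a list \<Rightarrow> 'b::ring_1 mat" where
  "adjacency_matrix \<Gamma> vs = mat (length vs) (length vs)
     (\<lambda>(i, j). if adjacent \<Gamma> (vs ! i) (vs ! j) then 1 else 0)"

definition laplacian_matrix :: "'a ugraph \<Rightarrow> 'a list \<Rightarrow> 'b::ring_1 mat" where
  "laplacian_matrix \<Gamma> vs = degree_matrix \<Gamma> vs - adjacency_matrix \<Gamma> vs"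

text \<open>Eigenvalues are taken over the complex numbers and counted with their algebraic
  multiplicity, so that their number is the number of vertices.\<close>

definition laplacian_spectrum :: "'a ugraph \<Rightarrow> 'a list \<Rightarrow> complex multiset" where
  "laplacian_spectrum \<Gamma> vs = proots (char_poly (laplacian_matrix \<Gamma> vs))"

end

theory Submission
  imports Defs "HOL-Library.Disjoint_Sets"
begin

text \<open>Since \<open>|G/Z(G)| = p\<^sup>2\<close>, Lagrange's theorem forces the centraliser of every non-central
  element to be abelian of order \<open>p |Z(G)|\<close>.  Hence commuting is an equivalence relation on
  \<open>G - Z(G)\<close> with \<open>p + 1\<close> classes of size \<open>m = (p - 1) |Z(G)|\<close>, and the non-commuting graph is
  complete multipartite.  With \<open>N\<close> the number of vertices and \<open>r\<close> the number of parts,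
  \<open>x I - L = (x - (N - m)) I + U B\<close>, where \<open>U\<close> is the vertex-part incidence matrix and \<open>B\<close> is the
  complement of its transpose.  Sylvester's determinant identity, applied to \<open>U B\<close> and once more to
  the all-ones matrix of size \<open>r\<close>, evaluates the characteristic polynomial.\<close>

section \<open>Sylvester's determinant identity\<close>

text \<open>The block matrix \<open>?M\<close> is made block upper triangular in two ways: on the
  right by \<open>?R\<close>, of determinant 1, and on the left by \<open>?L\<close>, of determinant
  \<open>y ^ k\<close>. The powers of \<open>y\<close> stay on both sides, so nothing is divided by
  \<open>y\<close> and \<open>y = 0\<close> is covered.\<close>

lemma sylvester_det:
  fixes A B :: "'a :: idom mat"
  assumes A: "A \<in> carrier_mat n k" and B: "B \<in> carrier_mat k n"
  shows "det (y \<cdot>\<^sub>m 1\<^sub>m n + A * B) * y ^ k = y ^ n * det (y \<cdot>\<^sub>m 1\<^sub>m k + B * A)"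
proof -
  let ?M = "four_block_mat (y \<cdot>\<^sub>m 1\<^sub>m n) (- A) B (1\<^sub>m k)"
  let ?R = "four_block_mat (1\<^sub>m n) (0\<^sub>m n k) (- B) (1\<^sub>m k)"
  let ?L = "four_block_mat (1\<^sub>m n) (0\<^sub>m n k) (- B) (y \<cdot>\<^sub>m 1\<^sub>m k)"
  have M: "?M \<in> carrier_mat (n + k) (n + k)" and R: "?R \<in> carrier_mat (n + k) (n + k)"
    and L: "?L \<in> carrier_mat (n + k) (n + k)"
    by (auto intro!: four_block_carrier_mat)
  have detR: "det ?R = 1"
    by (subst det_four_block_mat_upper_right_zero[of _ n _ k]) (use B in auto)
  have detL: "det ?L = y ^ k"
    by (subst det_four_block_mat_upper_right_zero[of _ n _ k]) (use B in \<open>auto simp: det_smult\<close>)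
  have "?M * ?R = four_block_mat (y \<cdot>\<^sub>m 1\<^sub>m n * 1\<^sub>m n + - A * - B) (y \<cdot>\<^sub>m 1\<^sub>m n * 0\<^sub>m n k + - A * 1\<^sub>m k)
      (B * 1\<^sub>m n + 1\<^sub>m k * - B) (B * 0\<^sub>m n k + 1\<^sub>m k * 1\<^sub>m k)"
    by (rule mult_four_block_mat) (use A B in auto)
  also have "\<dots> = four_block_mat (y \<cdot>\<^sub>m 1\<^sub>m n + A * B) (- A) (0\<^sub>m k n) (1\<^sub>m k)"
    by (rule cong_four_block_mat) (use A B in auto)
  finally have MR: "?M * ?R = \<dots>" .
  have detM: "det ?M = det (y \<cdot>\<^sub>m 1\<^sub>m n + A * B)"
    using arg_cong[OF MR, of det] detR
    by (simp add: det_mult[OF M R] det_four_block_mat_lower_left_zero[of _ n _ k]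
        mult_carrier_mat[OF A B] A B)
  have "?L * ?M = four_block_mat (1\<^sub>m n * (y \<cdot>\<^sub>m 1\<^sub>m n) + 0\<^sub>m n k * B) (1\<^sub>m n * - A + 0\<^sub>m n k * 1\<^sub>m k)
      (- B * (y \<cdot>\<^sub>m 1\<^sub>m n) + y \<cdot>\<^sub>m 1\<^sub>m k * B) (- B * - A + y \<cdot>\<^sub>m 1\<^sub>m k * 1\<^sub>m k)"
    by (rule mult_four_block_mat) (use A B in auto)
  also have "\<dots> = four_block_mat (y \<cdot>\<^sub>m 1\<^sub>m n) (- A) (0\<^sub>m k n) (y \<cdot>\<^sub>m 1\<^sub>m k + B * A)"
  proof (rule cong_four_block_mat)
    show "- B * (y \<cdot>\<^sub>m 1\<^sub>m n) + y \<cdot>\<^sub>m 1\<^sub>m k * B = 0\<^sub>m k n"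
      using B by (auto simp: mult_smult_distrib[of _ k n _ n] mult_smult_assoc_mat[of _ k k _ n])
    show "- B * - A + y \<cdot>\<^sub>m 1\<^sub>m k * 1\<^sub>m k = y \<cdot>\<^sub>m 1\<^sub>m k + B * A"
      using A B comm_add_mat[of "B * A" k k "y \<cdot>\<^sub>m 1\<^sub>m k"] by auto
  qed (use A B in auto)
  finally have LM: "?L * ?M = \<dots>" .
  have "det ?L * det ?M = y ^ n * det (y \<cdot>\<^sub>m 1\<^sub>m k + B * A)"
    using arg_cong[OF LM, of det]
    by (simp add: det_mult[OF L M] det_four_block_mat_lower_left_zero[of _ n _ k]
        mult_carrier_mat[OF B A] A B det_smult)
  then show ?thesis
    by (simp add: detL detM mult.commute)
qed

text \<open>The matrix is a scalar matrix plus the product of a constant column and a row of ones,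
  so Sylvester's identity with \<open>k = 1\<close> leaves a 1 by 1 determinant. The factor
  \<open>y\<close> on the left is the \<open>y ^ k\<close> of that identity.\<close>

lemma det_scalar_plus_const:
  fixes y c :: "'a :: idom"
  shows "det (mat n n (\<lambda>(i, j). (if i = j then y else 0) + c)) * y = y ^ n * (y + of_nat n * c)"
proof -
  let ?A = "mat n 1 (\<lambda>_. c)" and ?B = "mat 1 n (\<lambda>_. 1 :: 'a)"
  have "mat n n (\<lambda>(i, j). (if i = j then y else 0) + c) = y \<cdot>\<^sub>m 1\<^sub>m n + ?A * ?B"
    by (rule eq_matI) (auto simp: scalar_prod_def)
  moreover have "det (y \<cdot>\<^sub>m 1\<^sub>m 1 + ?B * ?A) = y + of_nat n * c"
    by (subst det_single) (auto simp: scalar_prod_def)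
  ultimately show ?thesis
    using sylvester_det[of ?A n 1 ?B y] by simp
qed

section \<open>Complete multipartite graphs\<close>

lemma partition_on_part_eq:
  assumes "partition_on A P" "c \<in> P" "d \<in> P" "x \<in> c" "x \<in> d"
  shows "d = c"
  using assms disjointD[of P c d] by (auto dest: partition_onD2)

text \<open>Parts are disjoint, so only the summand of \<open>c\<close> survives. This evaluates the
  entries of \<open>U * B\<close> below.\<close>

lemma sum_parts_containing:
  assumes part: "partition_on A P" and cs: "set cs = P" "distinct cs" and c: "c \<in> P" "x \<in> c"
  shows "(\<Sum>k<length cs. if x \<in> cs ! k then f (cs ! k) else 0) = (f c :: 'b :: comm_monoid_add)"
proof -
  have "(\<Sum>k<length cs. if x \<in> cs ! k then f (cs ! k) else 0) =
    (\<Sum>d\<in>P. if x \<in> d then f d else 0)"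
    using cs by (intro sum.reindex_bij_betw) (simp add: bij_betw_nth)
  also have "\<dots> = (\<Sum>d\<in>P. if d = c then f d else 0)"
  proof (rule sum.cong[OF refl])
    fix d assume "d \<in> P"
    then have "x \<in> d \<longleftrightarrow> d = c"
      using c partition_on_part_eq[OF part c(1) _ c(2)] by blast
    then show "(if x \<in> d then f d else 0) = (if d = c then f d else 0)" by simp
  qed
  also have "\<dots> = f c"
    using c cs by (auto simp: sum.delta)
  finally show ?thesis .
qed

lemma sum_nth_indicator:
  assumes "distinct vs" "c \<subseteq> set vs"
  shows "(\<Sum>i<length vs. if vs ! i \<in> c then 1 else 0) = (of_nat (card c) :: 'b :: semiring_1)"
proof -
  have "(\<Sum>i<length vs. if vs ! i \<in> c then 1 else 0 :: 'b) = (\<Sum>v\<in>set vs. if v \<in> c then 1 else 0)"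
    using assms by (intro sum.reindex_bij_betw) (simp add: bij_betw_nth)
  also have "\<dots> = of_nat (card (set vs \<inter> c))"
    by (simp add: sum.If_cases Int_def)
  also have "set vs \<inter> c = c" using assms by auto
  finally show ?thesis .
qed

text \<open>Sylvester's identity trades a determinant of size \<open>N\<close> for one of size
  \<open>r\<close>, the number of parts. The surplus linear factors are cancelled at the end, in the
  multisets of roots.\<close>

lemma laplacian_spectrum_complete_multipartite:
  assumes enum: "is_enumeration \<Gamma> vs" and part: "partition_on (verts \<Gamma>) P" and ne: "P \<noteq> {}"
    and size: "\<And>c. c \<in> P \<Longrightarrow> card c = m"
    and adj: "\<And>x y. x \<in> verts \<Gamma> \<Longrightarrow> y \<in> verts \<Gamma> \<Longrightarrow>
      adjacent \<Gamma> x y \<longleftrightarrow> \<not> (\<exists>c\<in>P. x \<in> c \<and> y \<in> c)"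
  shows "laplacian_spectrum \<Gamma> vs =
    {#0#} + replicate_mset (m * card P - card P) (of_nat (m * card P - m))
    + replicate_mset (card P - 1) (of_nat (m * card P))"
proof -
  define N where "N = length vs"
  define r where "r = card P"
  have vs: "distinct vs" "set vs = verts \<Gamma>"
    using enum by (auto simp: is_enumeration_def)
  have finV: "finite (verts \<Gamma>)" using vs by (metis List.finite_set)
  have finP: "finite P"
    using part finV by (metis finite_elements)
  obtain cs where cs: "set cs = P" "distinct cs"
    using finP finite_distinct_list by blast
  have lcs: "length cs = r" using cs distinct_card r_def by metis
  have N: "N = m * r"
  proof -
    have "m * card P = card (\<Union>P)"
      using part finP finV size
      by (intro card_partition) (auto simp: partition_on_def disjoint_def)
    also have "\<Union>P = set vs" using part vs by (auto simp: partition_on_def)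
    finally show ?thesis using vs distinct_card N_def r_def by metis
  qed
  have r: "r > 0" using ne finP by (simp add: r_def card_gt_0_iff)
  \<comment> \<open>Parts are non-empty; this later gives \<open>r \<le> N\<close>, so that
    \<open>N - r\<close> is a true difference.\<close>
  have m: "m > 0"
  proof -
    obtain c where c: "c \<in> P" using ne by auto
    with part finV have "c \<noteq> {}" "finite c"
      by (auto simp: partition_on_def intro: finite_subset)
    then show ?thesis using size[OF c] by (auto simp: card_gt_0_iff)
  qed
  have sub: "c \<subseteq> set vs" if "c \<in> P" for c
    using part vs that by (auto simp: partition_on_def)
  \<comment> \<open>The neighbours of a vertex are exactly the vertices outside its own
    part.\<close>
  have deg: "degree_of \<Gamma> x = N - m" if x: "x \<in> verts \<Gamma>" for x
  proof -
    obtain c where c: "c \<in> P" "x \<in> c" using part x by (auto simp: partition_on_def)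
    have "adjacent \<Gamma> x y \<longleftrightarrow> y \<notin> c" if "y \<in> verts \<Gamma>" for y
      using adj[OF x that] c partition_on_part_eq[OF part c(1) _ c(2)] by blast
    then have "{y \<in> verts \<Gamma>. adjacent \<Gamma> x y} = verts \<Gamma> - c"
      by blast
    then show ?thesis
      using card_Diff_subset[of c "verts \<Gamma>"] sub[OF c(1)] vs size[OF c(1)] finite_subset[OF _ finV]
      by (simp add: degree_of_def N_def distinct_card[symmetric])
  qed
  define U where "U = mat N r (\<lambda>(i, k). if vs ! i \<in> cs ! k then 1 else 0 :: complex)"
  define B where "B = mat r N (\<lambda>(k, j). if vs ! j \<in> cs ! k then 0 else 1 :: complex)"
  have U: "U \<in> carrier_mat N r" and B: "B \<in> carrier_mat r N"
    by (auto simp: U_def B_def)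
  define L :: "complex mat" where "L = laplacian_matrix \<Gamma> vs"
  have L: "L \<in> carrier_mat N N"
    by (auto simp: L_def laplacian_matrix_def degree_matrix_def adjacency_matrix_def N_def)
  have eval: "poly (char_poly L) x = det ((x - of_nat (N - m)) \<cdot>\<^sub>m 1\<^sub>m N + U * B)" for x
  proof -
    \<comment> \<open>\<open>char_matrix L x\<close> is \<open>L\<close> minus \<open>x\<close>
      times the identity, hence the sign.\<close>
    have "- char_matrix L x = (x - of_nat (N - m)) \<cdot>\<^sub>m 1\<^sub>m N + U * B"
    proof (rule eq_matI)
      fix i j
      assume "i < dim_row ((x - of_nat (N - m)) \<cdot>\<^sub>m 1\<^sub>m N + U * B)"
        "j < dim_col ((x - of_nat (N - m)) \<cdot>\<^sub>m 1\<^sub>m N + U * B)"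
      then have ij: "i < N" "j < N" using U B by auto
      then have mem: "vs ! i \<in> verts \<Gamma>" "vs ! j \<in> verts \<Gamma>"
        using vs N_def nth_mem by metis+
      obtain c where c: "c \<in> P" "vs ! i \<in> c" using part mem by (auto simp: partition_on_def)
      \<comment> \<open>The entry counts the parts containing \<open>vs ! i\<close> but not
        \<open>vs ! j\<close>, so \<open>U * B\<close> is the adjacency matrix.\<close>
      have "(U * B) $$ (i, j) =
        (\<Sum>k<length cs. if vs ! i \<in> cs ! k then (if vs ! j \<in> cs ! k then 0 else 1) else 0)"
        using ij by (auto simp: U_def B_def scalar_prod_def lcs atLeast0LessThan intro!: sum.cong)
      also have "\<dots> = (if vs ! j \<in> c then 0 else 1)"
        by (rule sum_parts_containing[OF part cs c])
      also have "\<dots> = (if adjacent \<Gamma> (vs ! i) (vs ! j) then 1 else 0)"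
        using adj[OF mem] c partition_on_part_eq[OF part c(1) _ c(2)] by (metis (full_types))
      finally show "(- char_matrix L x) $$ (i, j) =
          ((x - of_nat (N - m)) \<cdot>\<^sub>m 1\<^sub>m N + U * B) $$ (i, j)"
        using ij L U B deg[OF mem(1)]
        by (auto simp: char_matrix_def L_def laplacian_matrix_def degree_matrix_def
            adjacency_matrix_def N_def)
    qed (use L U B in \<open>auto simp: char_matrix_def\<close>)
    then show ?thesis by (simp add: char_poly_matrix[OF L])
  qed
  \<comment> \<open>Entry \<open>(k, l)\<close> counts the vertices of part \<open>l\<close> outside
    part \<open>k\<close>: none on the diagonal, \<open>m\<close> elsewhere. The form chosen is the
    one of \<open>det_scalar_plus_const\<close>.\<close>
  have BU: "B * U = mat r r (\<lambda>(k, l). (if k = l then - of_nat m else 0) + of_nat m)"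
  proof (rule eq_matI)
    fix k l assume "k < dim_row (mat r r (\<lambda>(k, l). (if k = l then - of_nat m else 0) + of_nat m :: complex))"
      "l < dim_col (mat r r (\<lambda>(k, l). (if k = l then - of_nat m else 0) + of_nat m :: complex))"
    then have kl: "k < r" "l < r" by auto
    have mem: "cs ! k \<in> P" "cs ! l \<in> P"
      using cs(1) lcs kl by (metis nth_mem)+
    have "(B * U) $$ (k, l) = (\<Sum>i<length vs. if vs ! i \<in> cs ! l - cs ! k then 1 else 0)"
      using kl by (auto simp: U_def B_def scalar_prod_def N_def atLeast0LessThan intro!: sum.cong)
    also have "\<dots> = of_nat (card (cs ! l - cs ! k))"
      using sub[OF mem(2)] by (intro sum_nth_indicator vs) auto
    also have "\<dots> = (if k = l then - of_nat m else 0) + of_nat m"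
    proof (cases "k = l")
      case False
      then have "cs ! k \<noteq> cs ! l" using cs(2) kl lcs by (simp add: nth_eq_iff_index_eq)
      then have "cs ! l - cs ! k = cs ! l"
        using part mem by (auto simp: partition_on_def disjoint_def)
      then show ?thesis using False size[OF mem(2)] by simp
    qed simp
    finally show "(B * U) $$ (k, l) =
        mat r r (\<lambda>(k, l). (if k = l then - of_nat m else 0) + of_nat m) $$ (k, l)"
      using kl by simp
  qed (auto simp: U_def B_def)
  \<comment> \<open>After the first use of Sylvester's identity the scalar part is
    \<open>y - m = x - N\<close>. The second use contributes \<open>(x - N) + r * m\<close>, which
    is \<open>x\<close> because \<open>N = m * r\<close>; this is the source of the eigenvalue
    0.\<close>
  have ev: "poly (char_poly L) x * (x - of_nat (N - m)) ^ r * (x - of_nat N) =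
      (x - of_nat (N - m)) ^ N * (x - of_nat N) ^ r * x" for x
  proof -
    define y where "y = x - of_nat (N - m)"
    have mN: "m \<le> N" using N r by simp
    have z: "y - of_nat m = x - of_nat N" using mN by (simp add: y_def of_nat_diff)
    have "y \<cdot>\<^sub>m 1\<^sub>m r + B * U = mat r r (\<lambda>(k, l). (if k = l then x - of_nat N else 0) + of_nat m)"
      unfolding BU z[symmetric] by (rule eq_matI) auto
    then have "det (y \<cdot>\<^sub>m 1\<^sub>m r + B * U) * (x - of_nat N) = (x - of_nat N) ^ r * x"
      using det_scalar_plus_const[of r "x - of_nat N" "of_nat m"]
      by (simp add: N mult.commute)
    then show ?thesis
      using sylvester_det[OF U B, of y] by (simp add: eval y_def[symmetric] mult.assoc)
  qed
  \<comment> \<open>Polynomials that agree at every complex number are equal. The linear factors are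
    kept unexpanded so that their roots can be read off.\<close>
  have poly_eq: "char_poly L * [:- of_nat (N - m), 1:] ^ r * [:- of_nat N, 1:] =
      [:- of_nat (N - m), 1:] ^ N * [:- of_nat N, 1:] ^ r * [:0, 1:]"
  proof (rule iffD1[OF poly_eq_poly_eq_iff], rule ext)
    have lin: "poly [:- a, 1:] x = x - a" "poly [:0, 1:] x = x" for a x :: complex
      by simp_all
    show "poly (char_poly L * [:- of_nat (N - m), 1:] ^ r * [:- of_nat N, 1:]) x =
        poly ([:- of_nat (N - m), 1:] ^ N * [:- of_nat N, 1:] ^ r * [:0, 1:]) x" for x
      by (simp only: poly_mult poly_power lin ev)
  qed
  \<comment> \<open>The roots of a product are the union with multiplicity only when the product is
    non-zero.\<close>
  have "char_poly L \<noteq> 0"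
    using degree_monic_char_poly[OF L] by auto
  with arg_cong[OF poly_eq, of proots] have *:
    "proots (char_poly L) + replicate_mset r (of_nat (N - m)) + {#of_nat N#} =
      replicate_mset N (of_nat (N - m)) + replicate_mset r (of_nat N) + {#0#}"
    by (simp add: proots_mult proots_power del: mult_pCons_left mult_pCons_right)
  \<comment> \<open>Both sides of \<open>*\<close> share \<open>r\<close> copies of
    \<open>N - m\<close> and one copy of \<open>N\<close>; these are split off and
    cancelled.\<close>
  have "r \<le> N" using m by (simp add: N)
  then have "replicate_mset N (of_nat (N - m) :: complex) =
      replicate_mset (N - r) (of_nat (N - m)) + replicate_mset r (of_nat (N - m))"
    by (simp add: multiset_eq_iff)
  moreover have "replicate_mset r (of_nat N :: complex) =
      replicate_mset (r - 1) (of_nat N) + {#of_nat N#}"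
    using r by (cases r) auto
  ultimately have "proots (char_poly L) =
      {#0#} + replicate_mset (N - r) (of_nat (N - m)) + replicate_mset (r - 1) (of_nat N)"
    using * by (simp add: add.assoc add.commute add.left_commute)
  then show ?thesis
    by (simp add: laplacian_spectrum_def L_def N r_def)
qed

text \<open>An edge determines its endpoints only up to order, which is harmless as non-commuting is
  symmetric.\<close>

lemma adjacent_noncommuting_graph:
  "adjacent (noncommuting_graph G) x y \<longleftrightarrow>
    x \<in> carrier G - centre G \<and> y \<in> carrier G - centre G \<and> x \<otimes>\<^bsub>G\<^esub> y \<noteq> y \<otimes>\<^bsub>G\<^esub> x"
  unfolding adjacent_def noncommuting_graph_def edges_def snd_conv mem_Collect_eq doubleton_eq_iff
  by metis

section \<open>Groups whose central quotient has order $p^2$\<close>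

text \<open>Taking a set \<open>S\<close> covers at once the centre, the centraliser of an element
  \<open>x\<close> (as \<open>S = {x}\<close>) and the centre of a subgroup.\<close>

definition centraliser :: "('a, 'b) monoid_scheme \<Rightarrow> 'a set \<Rightarrow> 'a set" where
  "centraliser G S = {z \<in> carrier G. \<forall>x\<in>S. z \<otimes>\<^bsub>G\<^esub> x = x \<otimes>\<^bsub>G\<^esub> z}"

lemma centre_eq_centraliser: "centre G = centraliser G (carrier G)"
  by (simp add: centre_def centraliser_def)

lemma square_diff_one_nat: "(n::nat)\<^sup>2 - 1 = (n - 1) * (n + 1)"
  by (cases n) (simp_all add: power2_eq_square algebra_simps)

context group
begin

lemma subgroup_centraliser:
  assumes S: "S \<subseteq> carrier G"
  shows "subgroup (centraliser G S) G"
proof (rule subgroupI)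
  show "centraliser G S \<noteq> {}"
    using S by (auto simp: centraliser_def intro!: exI[of _ \<one>])
next
  fix a assume a: "a \<in> centraliser G S"
  show "inv a \<in> centraliser G S"
    unfolding centraliser_def
  proof (clarsimp, intro conjI ballI)
    fix x assume "x \<in> S"
    with a S have "a \<in> carrier G" "x \<in> carrier G" "a \<otimes> x = x \<otimes> a"
      by (auto simp: centraliser_def)
    then show "inv a \<otimes> x = x \<otimes> inv a"
      by (metis inv_closed inv_solve_left inv_solve_right' m_assoc m_closed)
  qed (use a in \<open>simp add: centraliser_def\<close>)
next
  fix a b assume a: "a \<in> centraliser G S" and b: "b \<in> centraliser G S"
  show "a \<otimes> b \<in> centraliser G S"
    unfolding centraliser_def
  proof (clarsimp, intro conjI ballI)
    fix x assume "x \<in> S"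
    with a b S have "a \<in> carrier G" "b \<in> carrier G" "x \<in> carrier G"
      "a \<otimes> x = x \<otimes> a" "b \<otimes> x = x \<otimes> b"
      by (auto simp: centraliser_def)
    then show "a \<otimes> b \<otimes> x = x \<otimes> (a \<otimes> b)"
      by (metis m_assoc)
  qed (use a b in \<open>simp_all add: centraliser_def\<close>)
qed (auto simp: centraliser_def)

lemma subgroup_card_dvd:
  assumes "subgroup H G" "subgroup K G" "H \<subseteq> K"
  shows "card H dvd card K"
proof -
  interpret K: group "G\<lparr>carrier := K\<rparr>"
    using assms(2) by (rule subgroup_imp_group)
  have "subgroup H (G\<lparr>carrier := K\<rparr>)"
    using assms by (intro subgroup_incl)
  from K.lagrange[OF this] have "card H dvd Coset.order (G\<lparr>carrier := K\<rparr>)"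
    by (metis dvd_triv_right)
  then show ?thesis by (simp add: Coset.order_def)
qed

text \<open>By Lagrange, the index \<open>q\<close> of \<open>H\<close> in \<open>K\<close> divides
  \<open>p\<^sup>2\<close>, so it is a power of \<open>p\<close>; the strict inclusions exclude 1
  and \<open>p\<^sup>2\<close>.\<close>

lemma card_subgroup_between:
  assumes fin: "finite (carrier G)" and p: "Factorial_Ring.prime p"
    and H: "subgroup H G" and K: "subgroup K G" and J: "subgroup J G"
    and sub: "H \<subset> K" "K \<subset> J" and card: "card J = p\<^sup>2 * card H"
  shows "card K = p * card H"
proof -
  have finJ: "finite J" using J fin by (meson finite_subset subgroup.subset)
  then have finK: "finite K" using sub finite_subset by blast
  have H0: "card H > 0" using H fin by (simp add: subgroup.finite_imp_card_positive)
  obtain q where q: "card K = card H * q"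
    using subgroup_card_dvd[OF H K] sub by (auto elim: dvdE)
  have "card K dvd card J" using subgroup_card_dvd[OF K J] sub by auto
  then have "q dvd p\<^sup>2" using q card H0 by (simp add: mult.commute)
  then obtain i where i: "i \<le> 2" "q = p ^ i"
    using divides_primepow_nat[OF p] by blast
  have "card H < card K" "card K < card J"
    using sub finK finJ by (auto intro: psubset_card_mono)
  then have "q \<noteq> 1" "q \<noteq> p\<^sup>2" using q card by auto
  then have "i \<noteq> 0" "i \<noteq> 2" using i by auto
  then have "i = 1" using i by linarith
  then show ?thesis using q i by simp
qed

section \<open>Centralisers and commuting classes when the centre has index p^2\<close>

context
  fixes p
  assumes fin: "finite (carrier G)" and p: "Factorial_Ring.prime p"
    and card: "card (carrier G) = p\<^sup>2 * card (centre G)"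
begin

lemma centre_psubset_centraliser:
  assumes x: "x \<in> carrier G - centre G"
  shows "centre G \<subset> centraliser G {x}" "centraliser G {x} \<subset> carrier G"
proof -
  have "centre G \<subseteq> centraliser G {x}" "x \<in> centraliser G {x}"
    using x by (auto simp: centre_def centraliser_def)
  then show "centre G \<subset> centraliser G {x}" using x by blast
  have "centraliser G {x} \<noteq> carrier G"
  proof
    assume "centraliser G {x} = carrier G"
    then have "y \<otimes> x = x \<otimes> y" if "y \<in> carrier G" for y
      using that by (auto simp: centraliser_def set_eq_iff)
    then show False using x by (simp add: centre_def)
  qed
  then show "centraliser G {x} \<subset> carrier G" by (auto simp: centraliser_def)
qed

lemma card_centraliser:
  assumes x: "x \<in> carrier G - centre G"
  shows "card (centraliser G {x}) = p * card (centre G)"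
proof (rule card_subgroup_between[OF fin p _ _ subgroup_self])
  show "subgroup (centre G) G" "subgroup (centraliser G {x}) G"
    using x by (simp_all add: centre_eq_centraliser subgroup_centraliser)
qed (fact centre_psubset_centraliser[OF x] card)+

text \<open>Let \<open>D\<close> be the centre of the centraliser \<open>C\<close> of
  \<open>x\<close>. It contains \<open>centre G\<close> and also \<open>x\<close>, so strictly more
  than \<open>centre G\<close>. The index of \<open>centre G\<close> in \<open>D\<close> divides the
  prime \<open>p\<close> and is not 1, which forces \<open>D = C\<close>.\<close>

lemma centraliser_commute:
  assumes x: "x \<in> carrier G - centre G"
    and y: "y \<in> centraliser G {x}" and z: "z \<in> centraliser G {x}"
  shows "y \<otimes> z = z \<otimes> y"
proof -
  define C where "C = centraliser G {x}"
  define D where "D = C \<inter> centraliser G C"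
  have C: "subgroup C G" unfolding C_def using x by (intro subgroup_centraliser) auto
  have D: "subgroup D G"
    unfolding D_def by (intro subgroups_Inter_pair C subgroup_centraliser subgroup.subset)
  have Z: "subgroup (centre G) G"
    by (simp add: centre_eq_centraliser subgroup_centraliser)
  have finC: "finite C" using fin by (simp add: C_def centraliser_def)
  have Z0: "card (centre G) > 0" using Z fin by (simp add: subgroup.finite_imp_card_positive)
  have "centre G \<subseteq> D" "x \<in> D"
    using x by (auto simp: C_def D_def centre_def centraliser_def)
  then have ZD: "centre G \<subset> D" using x by auto
  have DC: "D \<subseteq> C" by (simp add: D_def)
  obtain q where q: "card D = card (centre G) * q"
    using subgroup_card_dvd[OF Z D] ZD by (auto elim: dvdE)
  have "card D dvd p * card (centre G)"
    using subgroup_card_dvd[OF D C DC] card_centraliser[OF x] by (simp add: C_def)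
  then have "q dvd p" using q Z0 by (simp add: mult.commute)
  moreover have "card (centre G) < card D"
    using ZD DC finC by (meson finite_subset psubset_card_mono)
  then have "q \<noteq> 1" using q by auto
  ultimately have "q = p" using p by (auto simp: prime_nat_iff)
  then have "card D = card C" using q card_centraliser[OF x] by (simp add: C_def mult.commute)
  then have "D = C" using DC finC by (simp add: card_subset_eq)
  then show ?thesis using y z by (auto simp: C_def D_def centraliser_def)
qed

text \<open>Since the centraliser of \<open>x\<close> is abelian, it lies in that of
  \<open>y\<close>; both have the same finite cardinality. This is transitivity of commuting on
  non-central elements.\<close>

lemma centraliser_diff_eq:
  assumes x: "x \<in> carrier G - centre G" and y: "y \<in> centraliser G {x} - centre G"
  shows "centraliser G {y} = centraliser G {x}"
proof -
  have y': "y \<in> carrier G - centre G" using y by (simp add: centraliser_def)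
  have "centraliser G {x} \<subseteq> centraliser G {y}"
    using centraliser_commute[OF x _ ] y by (auto simp: centraliser_def)
  moreover have "finite (centraliser G {y})" using fin by (simp add: centraliser_def)
  ultimately show ?thesis
    using card_centraliser[OF x] card_centraliser[OF y']
      card_subset_eq[of "centraliser G {y}" "centraliser G {x}"] by simp
qed

definition commuting_classes :: "'a set set" where
  "commuting_classes = (\<lambda>x. centraliser G {x} - centre G) ` (carrier G - centre G)"

text \<open>An element \<open>z\<close> common to two classes has the same centraliser as both
  representatives, so the classes coincide.\<close>

lemma partition_on_commuting_classes:
  "partition_on (carrier G - centre G) commuting_classes"
proof (rule partition_onI)
  show "\<Union>commuting_classes = carrier G - centre G"
    by (auto simp: commuting_classes_def centraliser_def)
  show "{} \<notin> commuting_classes"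
    using centre_psubset_centraliser(1) by (auto simp: commuting_classes_def)
  fix c d assume cd: "c \<in> commuting_classes" "d \<in> commuting_classes" "c \<noteq> d"
  then obtain x y where x: "x \<in> carrier G - centre G" "c = centraliser G {x} - centre G"
    and y: "y \<in> carrier G - centre G" "d = centraliser G {y} - centre G"
    by (auto simp: commuting_classes_def)
  show "disjnt c d"
  proof (rule ccontr)
    assume "\<not> disjnt c d"
    then obtain z where "z \<in> c" "z \<in> d" by (auto simp: disjnt_def)
    then have "centraliser G {x} = centraliser G {y}"
      using x y centraliser_diff_eq by metis
    then show False using x y cd by simp
  qed
qed

lemma card_commuting_class:
  assumes "c \<in> commuting_classes"
  shows "card c = (p - 1) * card (centre G)"
proof -
  obtain x where x: "x \<in> carrier G - centre G" "c = centraliser G {x} - centre G"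
    using assms unfolding commuting_classes_def by blast
  have "finite (centre G)" using fin by (simp add: centre_def)
  moreover have "centre G \<subseteq> centraliser G {x}"
    using centre_psubset_centraliser(1)[OF x(1)] by (rule psubset_imp_subset)
  ultimately have "card c = card (centraliser G {x}) - card (centre G)"
    unfolding x(2) by (rule card_Diff_subset)
  then show ?thesis
    by (simp only: card_centraliser[OF x(1)] diff_mult_distrib mult_1)
qed

text \<open>Commuting elements both lie in the class of \<open>x\<close>; conversely, elements of
  one class lie in a common abelian centraliser.\<close>

lemma commute_iff_commuting_classes:
  assumes x: "x \<in> carrier G - centre G" and y: "y \<in> carrier G - centre G"
  shows "x \<otimes> y = y \<otimes> x \<longleftrightarrow> (\<exists>c\<in>commuting_classes. x \<in> c \<and> y \<in> c)"
proof
  assume "x \<otimes> y = y \<otimes> x"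
  then have "x \<in> centraliser G {x} - centre G \<and> y \<in> centraliser G {x} - centre G"
    using x y by (simp add: centraliser_def)
  then show "\<exists>c\<in>commuting_classes. x \<in> c \<and> y \<in> c"
    unfolding commuting_classes_def using x by (rule bexI[OF _ imageI])
next
  assume "\<exists>c\<in>commuting_classes. x \<in> c \<and> y \<in> c"
  then obtain z where "z \<in> carrier G - centre G" "x \<in> centraliser G {z}" "y \<in> centraliser G {z}"
    unfolding commuting_classes_def by blast
  then show "x \<otimes> y = y \<otimes> x" by (rule centraliser_commute)
qed

text \<open>Classes of equal size \<open>(p - 1) * card (centre G)\<close> fill a set of
  \<open>(p\<^sup>2 - 1) * card (centre G)\<close> elements, and p^2 - 1 = (p - 1)(p + 1).\<close>

lemma card_commuting_classes: "card commuting_classes = p + 1"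
proof -
  have p2: "p \<ge> 2" using p by (rule prime_ge_2_nat)
  have "subgroup (centre G) G"
    by (simp add: centre_eq_centraliser subgroup_centraliser)
  then have Z0: "card (centre G) > 0" and sub: "centre G \<subseteq> carrier G"
    using fin by (auto simp: subgroup.finite_imp_card_positive subgroup.subset)
  have "(p - 1) * card (centre G) * card commuting_classes = card (\<Union>commuting_classes)"
    using partition_on_commuting_classes fin card_commuting_class
    by (intro card_partition finite_elements[of "carrier G - centre G"])
      (auto simp: partition_on_def disjoint_def)
  also have "\<dots> = card (carrier G - centre G)"
    using partition_on_commuting_classes by (simp add: partition_on_def)
  also have "\<dots> = p\<^sup>2 * card (centre G) - card (centre G)"
    using card_Diff_subset[OF finite_subset[OF sub fin] sub] card by simp
  also have "\<dots> = (p\<^sup>2 - 1) * card (centre G)"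
    by (simp add: diff_mult_distrib)
  also have "\<dots> = (p - 1) * card (centre G) * (p + 1)"
    by (simp only: square_diff_one_nat mult.assoc mult.commute[of "p + 1" "card (centre G)"])
  finally have "(p - 1) * card (centre G) * card commuting_classes =
      (p - 1) * card (centre G) * (p + 1)" .
  moreover have "(p - 1) * card (centre G) \<noteq> 0" using p2 Z0 by simp
  ultimately show ?thesis by (simp only: mult_cancel1 simp_thms)
qed

end

end

theorem theorem3p2:
  fixes G :: "('a, 'b) monoid_scheme" and p :: nat and vs :: "'a list"
  assumes "Factorial_Ring.prime p"
    and "group G"
    and "finite (carrier G)"
    and "G Mod (centre G) \<cong> integer_mod_group p \<times>\<times> integer_mod_group p"
    and "is_enumeration (noncommuting_graph G) vs"
  shows "laplacian_spectrum (noncommuting_graph G) vs =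
    {#0#}
    + replicate_mset ((p^2 - 1) * card (centre G) - p - 1)
        (of_nat ((p^2 - p) * card (centre G)))
    + replicate_mset p (of_nat ((p^2 - 1) * card (centre G)))"
proof -
  let ?\<Gamma> = "noncommuting_graph G" and ?k = "card (centre G)"
  interpret group G by fact
  note p = assms(1)
  have p2: "p \<ge> 2" using p by (rule prime_ge_2_nat)
  have Z: "subgroup (centre G) G"
    by (simp add: centre_eq_centraliser subgroup_centraliser)
  have Z0: "?k > 0" using Z assms(3) by (simp add: subgroup.finite_imp_card_positive)
  have "card (rcosets\<^bsub>G\<^esub> centre G) = p\<^sup>2"
  proof -
    obtain h where "h \<in> iso (G Mod centre G) (integer_mod_group p \<times>\<times> integer_mod_group p)"
      using assms(4) by (auto simp: is_iso_def)
    then have "card (carrier (G Mod centre G)) =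
        card (carrier (integer_mod_group p \<times>\<times> integer_mod_group p))"
      by (auto simp: iso_def intro: bij_betw_same_card)
    then show ?thesis
      \<comment> \<open>\<open>integer_mod_group 0\<close> is the infinite group of integers, so
        \<open>p2\<close> is what makes each factor have \<open>p\<close> elements.\<close>
      using p2 by (simp add: FactGroup_def carrier_integer_mod_group power2_eq_square
          card_cartesian_product)
  qed
  then have card: "card (carrier G) = p\<^sup>2 * ?k"
    using lagrange[OF Z] by (simp add: Coset.order_def)
  note classes = assms(3) p card
  let ?P = "commuting_classes"
  let ?m = "(p - 1) * ?k"
  have verts: "verts ?\<Gamma> = carrier G - centre G"
    by (simp add: noncommuting_graph_def verts_def)
  have cP: "card ?P = p + 1" by (rule card_commuting_classes[OF classes])
  have "laplacian_spectrum ?\<Gamma> vs =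
    {#0#} + replicate_mset (?m * card ?P - card ?P) (of_nat (?m * card ?P - ?m))
    + replicate_mset (card ?P - 1) (of_nat (?m * card ?P))"
  proof (rule laplacian_spectrum_complete_multipartite[OF assms(5)])
    show "partition_on (verts ?\<Gamma>) ?P"
      unfolding verts by (rule partition_on_commuting_classes[OF classes])
    show "?P \<noteq> {}" using cP by auto
    show "card c = ?m" if "c \<in> ?P" for c by (rule card_commuting_class[OF classes that])
    show "adjacent ?\<Gamma> x y \<longleftrightarrow> \<not> (\<exists>c\<in>?P. x \<in> c \<and> y \<in> c)"
      if "x \<in> verts ?\<Gamma>" "y \<in> verts ?\<Gamma>" for x y
      using that unfolding verts adjacent_noncommuting_graph
      by (metis commute_iff_commuting_classes[OF classes])
  qed
  \<comment> \<open>With \<open>p + 1\<close> parts of size \<open>?m\<close>, this is the number of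
    vertices; the next line is the common degree.\<close>
  moreover have "?m * (p + 1) = (p\<^sup>2 - 1) * ?k"
    by (simp only: square_diff_one_nat mult.assoc mult.commute[of "p + 1" "card (centre G)"])
  moreover have "(p\<^sup>2 - 1) * ?k - ?m = (p\<^sup>2 - p) * ?k"
    using p2 by (simp flip: diff_mult_distrib)
  ultimately show ?thesis
    by (simp only: cP diff_diff_left add_diff_cancel_right')
qed

end
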